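(* Let $X$ be a Banach space and let $\eta$ be a homogeneous and convexifiable measure of non-compactness on $X^*$ with convexifiability constant $\kappa$. Assume that $A$ is a weak$^*$-compact subset of $X^*$ such that $[\eta]'_\varepsilon(A)\subset\lambda A$ for some $\lambda\in(0,1)$ and $\varepsilon>0$. Then for every $\varepsilon'>\varepsilon$, $$\langle\eta\rangle^\omega_{\kappa\varepsilon'}(\overline{\mathrm{conv}}^*(A))=\emptyset.$$
   Context: A measure of non-compactness on $X^*$ is a map $\eta$ from the weak$^*$-compact subsets of $X^*$ to $[0,\infty)$ such that: (i) $\eta(\{x^*\})=0$ for all $x^*\in X^*$; (ii) $\eta(\bigcup_{i=1}^nA_i)=\max_i\eta(A_i)$ for weak$^*$-compact $A_1,\dots,A_n$; (iii) there is $b>0$ with $\eta(A+\lambda B_{X^*})\le\eta(A)+\lambda b$ for all weak$^*$-compact $A$ and $\lambda>0$ ($B_{X^*}$ the closed unit ball of $X^*$). $\eta$ is homogeneous if $\eta(\lambda A)=|\lambda|\eta(A)$ for all weak$^*$-compact $A$ and $\lambda\in\mathbb R$. $\eta$ is convexifiable if there is $\kappa\ge1$ such that $\eta(\overline{\mathrm{conv}}^*(A))\le\kappa\,\eta(A)$ for all weak$^*$-compact $A$, where $\overline{\mathrm{conv}}^*$ is the weak$^*$-closed convex hull; the smallest such $\kappa$ is the convexifiability constant of $\eta$. Write $\overline{E}^*$ for the weak$^*$-closure. Fragment derivation: $[\eta]'_\varepsilon(A)=\{x^*\in A:\ \eta(A\cap\overline{U}^* )\ge\varepsilon$ for every weak$^*$-neighborhood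 $U$ of $x^*\}$. Slice derivation: $\langle\eta\rangle'_\varepsilon(A)=\{x^*\in A:\ \eta(A\cap\overline{H}^* )\ge\varepsilon$ for every weak$^*$-open halfspace $H$ containing $x^*\}$. Inductively $\langle\eta\rangle^0_\varepsilon(A)=A$, $\langle\eta\rangle^{k+1}_\varepsilon(A)=\langle\eta\rangle'_\varepsilon(\langle\eta\rangle^k_\varepsilon(A))$, $\langle\eta\rangle^\omega_\varepsilon(A)=\bigcap_{k<\omega}\langle\eta\rangle^k_\varepsilon(A)$. *)

theory Defs
  imports "HOL-Analysis.Analysis"
begin

text \<open>The dual of a real normed space \<open>'a\<close> is the type \<open>'a \<Rightarrow>\<^sub>L real\<close>. For real-valued
  operators the strong operator topology, i.e. the topology of pointwise convergence on \<open>'a\<close>,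
  is the weak* topology.\<close>

abbreviation weak_star :: "('a::real_normed_vector \<Rightarrow>\<^sub>L real) topology"
  where "weak_star \<equiv> strong_operator_topology"

definition weak_star_closed_hull ::
    "('a::real_normed_vector \<Rightarrow>\<^sub>L real) set \<Rightarrow> ('a \<Rightarrow>\<^sub>L real) set"
  where "weak_star_closed_hull A = weak_star closure_of (convex hull A)"

definition weak_star_neighbourhood ::
    "('a::real_normed_vector \<Rightarrow>\<^sub>L real) \<Rightarrow> ('a \<Rightarrow>\<^sub>L real) set \<Rightarrow> bool"
  where "weak_star_neighbourhood f U \<longleftrightarrow> (\<exists>V. openin weak_star V \<and> f \<in> V \<and> V \<subseteq> U)"

text \<open>The weak*-continuous linear functionals are the evaluations at points \<open>x\<close>. The degenerate
  case \<open>x = 0\<close>, which yields the empty set and the whole space, is not excluded. For weak*-compact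
  sets in the dual of a nonzero Banach space this does not affect the slice derivation: such a set
  is bounded, hence contained in a proper halfspace. For the zero space it keeps the family of
  halfspaces from being empty.\<close>

definition weak_star_open_halfspace :: "('a::real_normed_vector \<Rightarrow>\<^sub>L real) set \<Rightarrow> bool"
  where "weak_star_open_halfspace H \<longleftrightarrow> (\<exists>x a. H = {f. blinfun_apply f x > a})"

text \<open>A map on the weak*-compact sets is represented by a function on all sets of functionals, of
  which only the values at weak*-compact sets are constrained or used.\<close>

definition measure_of_noncompactness ::
    "(('a::real_normed_vector \<Rightarrow>\<^sub>L real) set \<Rightarrow> real) \<Rightarrow> bool"
  where "measure_of_noncompactness \<eta> \<longleftrightarrow>
    (\<forall>A. compactin weak_star A \<longrightarrow> 0 \<le> \<eta> A) \<and>
    (\<forall>f. \<eta> {f} = 0) \<and>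
    (\<forall>(n::nat) A. 1 \<le> n \<and> (\<forall>i\<in>{1..n}. compactin weak_star (A i)) \<longrightarrow>
       \<eta> (\<Union>i\<in>{1..n}. A i) = Max ((\<lambda>i. \<eta> (A i)) ` {1..n})) \<and>
    (\<exists>b>0. \<forall>A r. compactin weak_star A \<and> 0 < r \<longrightarrow>
       \<eta> {f + r *\<^sub>R g | f g. f \<in> A \<and> g \<in> cball 0 1} \<le> \<eta> A + r * b)"

definition homogeneous :: "(('a::real_normed_vector \<Rightarrow>\<^sub>L real) set \<Rightarrow> real) \<Rightarrow> bool"
  where "homogeneous \<eta> \<longleftrightarrow>
    (\<forall>A r. compactin weak_star A \<longrightarrow> \<eta> ((\<lambda>f. r *\<^sub>R f) ` A) = \<bar>r\<bar> * \<eta> A)"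

definition convexifiable_with ::
    "(('a::real_normed_vector \<Rightarrow>\<^sub>L real) set \<Rightarrow> real) \<Rightarrow> real \<Rightarrow> bool"
  where "convexifiable_with \<eta> \<kappa> \<longleftrightarrow> 1 \<le> \<kappa> \<and>
    (\<forall>A. compactin weak_star A \<longrightarrow> \<eta> (weak_star_closed_hull A) \<le> \<kappa> * \<eta> A)"

definition convexifiable :: "(('a::real_normed_vector \<Rightarrow>\<^sub>L real) set \<Rightarrow> real) \<Rightarrow> bool"
  where "convexifiable \<eta> \<longleftrightarrow> (\<exists>\<kappa>. convexifiable_with \<eta> \<kappa>)"

definition convexifiability_constant ::
    "(('a::real_normed_vector \<Rightarrow>\<^sub>L real) set \<Rightarrow> real) \<Rightarrow> real"
  where "convexifiability_constant \<eta> = (LEAST \<kappa>. convexifiable_with \<eta> \<kappa>)"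

text \<open>The least constant exists, so the \<open>LEAST\<close> above is never a junk value for convexifiable
  \<open>\<eta>\<close>.\<close>

lemma convexifiable_with_constant:
  assumes "convexifiable \<eta>"
  shows "convexifiable_with \<eta> (convexifiability_constant \<eta>)"
proof -
  let ?K = "{\<kappa>. convexifiable_with \<eta> \<kappa>}"
  have ne: "?K \<noteq> {}" using assms by (auto simp: convexifiable_def)
  have bdd: "bdd_below ?K"
    by (rule bdd_belowI[of _ 1]) (auto simp: convexifiable_with_def)
  have "?K = {1..} \<inter> (\<Inter>A\<in>{A. compactin weak_star A}. {\<kappa>. \<eta> (weak_star_closed_hull A) \<le> \<kappa> * \<eta> A})"
    by (auto simp: convexifiable_with_def)
  moreover have "closed {\<kappa>. \<eta> (weak_star_closed_hull A) \<le> \<kappa> * \<eta> A}" for A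
    by (rule closed_Collect_le) (rule continuous_intros)+
  ultimately have "closed ?K"
    by (metis (no_types, lifting) closed_INT closed_Int closed_atLeast)
  then have Inf_in: "convexifiable_with \<eta> (Inf ?K)"
    using closed_contains_Inf[OF ne bdd] by blast
  have Inf_le: "Inf ?K \<le> \<kappa>" if "convexifiable_with \<eta> \<kappa>" for \<kappa>
    using that bdd by (meson cInf_lower mem_Collect_eq)
  have "convexifiability_constant \<eta> = Inf ?K"
    unfolding convexifiability_constant_def using Inf_in Inf_le by (rule Least_equality)
  with Inf_in show ?thesis by metis
qed

definition fragment_derivation ::
    "(('a::real_normed_vector \<Rightarrow>\<^sub>L real) set \<Rightarrow> real) \<Rightarrow> real \<Rightarrow> ('a \<Rightarrow>\<^sub>L real) set \<Rightarrow> ('a \<Rightarrow>\<^sub>L real) set"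
  where "fragment_derivation \<eta> \<epsilon> A =
    {f \<in> A. \<forall>U. weak_star_neighbourhood f U \<longrightarrow> \<epsilon> \<le> \<eta> (A \<inter> (weak_star closure_of U))}"

definition slice_derivation ::
    "(('a::real_normed_vector \<Rightarrow>\<^sub>L real) set \<Rightarrow> real) \<Rightarrow> real \<Rightarrow> ('a \<Rightarrow>\<^sub>L real) set \<Rightarrow> ('a \<Rightarrow>\<^sub>L real) set"
  where "slice_derivation \<eta> \<epsilon> A =
    {f \<in> A. \<forall>H. weak_star_open_halfspace H \<and> f \<in> H \<longrightarrow> \<epsilon> \<le> \<eta> (A \<inter> (weak_star closure_of H))}"

definition slice_derivation_omega ::
    "(('a::real_normed_vector \<Rightarrow>\<^sub>L real) set \<Rightarrow> real) \<Rightarrow> real \<Rightarrow> ('a \<Rightarrow>\<^sub>L real) set \<Rightarrow> ('a \<Rightarrow>\<^sub>L real) set"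
  where "slice_derivation_omega \<eta> \<epsilon> A = (\<Inter>k::nat. (slice_derivation \<eta> \<epsilon> ^^ k) A)"

end

theory Submission
  imports Defs
begin

text \<open>Let \<open>K\<close> be the weak*-closed convex hull of \<open>A\<close>. If \<open>f \<in> K\<close> lies outside \<open>\<mu>K\<close>, some \<open>x\<close>
  separates it from \<open>\<mu>K\<close>, so \<open>M = sup\<^sub>A x\<close> is positive and \<open>f(x) > \<mu>M\<close>. For \<open>lam < L < 1\<close> the part
  \<open>S\<close> of \<open>A\<close> where \<open>x \<ge> LM\<close> misses \<open>lam A\<close>, hence the fragment derivative, and a finite cover gives
  \<open>\<eta>(S) < \<epsilon>\<close>. When \<open>\<mu>\<close> is close to 1, points of \<open>K\<close> where \<open>x \<ge> \<mu>M\<close> are convex combinations with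
  almost all their mass on \<open>S\<close>, so this slice lies within a small distance of the closed convex hull
  of \<open>S\<close> and its measure is less than \<open>\<kappa>\<epsilon>'\<close>. As \<open>\<mu>\<close> does not depend on \<open>x\<close>, the slice derivation maps
  \<open>K\<close> into \<open>\<mu>K\<close>; by homogeneity its \<open>k\<close>-th iterate lies in \<open>\<mu>\<^sup>kK\<close>, and once
  \<open>\<mu>\<^sup>k\<eta>(K) < \<kappa>\<epsilon>'\<close> the next one is empty.\<close>

subsection \<open>The weak* topology\<close>

text \<open>The topology is pulled back from a product, where a basic open set restricts only
  finitely many coordinates. Exact agreement on \<open>I\<close> is all that the separation argument
  needs.\<close>

lemma openin_weak_star_finite:
  assumes "openin weak_star V" "f \<in> V"
  obtains I where "finite I" "\<And>g. (\<And>x. x \<in> I \<Longrightarrow> blinfun_apply g x = blinfun_apply f x) \<Longrightarrow> g \<in> V"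
proof -
  obtain U where U: "open U" and V: "V = blinfun_apply -` U"
    using assms(1) unfolding strong_operator_topology_def openin_pullback_topology by auto
  have "openin (product_topology (\<lambda>i. euclidean) UNIV) U" "blinfun_apply f \<in> U"
    using U V assms(2) by (auto simp: euclidean_product_topology)
  then obtain X where X: "finite {i. X i \<noteq> UNIV}" "blinfun_apply f \<in> Pi\<^sub>E UNIV X" "Pi\<^sub>E UNIV X \<subseteq> U"
    unfolding openin_product_topology_alt by (fastforce)
  show thesis
  proof (rule that[OF X(1)])
    fix g assume g: "\<And>x. x \<in> {i. X i \<noteq> UNIV} \<Longrightarrow> blinfun_apply g x = blinfun_apply f x"
    have "blinfun_apply g \<in> Pi\<^sub>E UNIV X"
      using X(2) g by (fastforce simp: PiE_iff)
    then show "g \<in> V" using X(3) V by auto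
  qed
qed

lemma Hausdorff_weak_star: "Hausdorff_space weak_star"
  unfolding Hausdorff_space_def
proof (intro allI impI)
  fix f g :: "'a \<Rightarrow>\<^sub>L real"
  assume "f \<in> topspace weak_star \<and> g \<in> topspace weak_star \<and> f \<noteq> g"
  then obtain x where "blinfun_apply f x \<noteq> blinfun_apply g x"
    by (meson blinfun_eqI)
  then obtain U V where UV: "open U" "open V" "f x \<in> U" "g x \<in> V" "U \<inter> V = {}"
    using hausdorff[of "f x" "g x"] by auto
  have "openin weak_star {h. \<forall>i\<in>{x}. blinfun_apply h i \<in> W}" if "open W" for W
    by (rule strong_operator_topology_basis) (use that in auto)
  then have "openin weak_star {h. blinfun_apply h x \<in> U}" "openin weak_star {h. blinfun_apply h x \<in> V}"
    using UV by auto
  then show "\<exists>U V. openin weak_star U \<and> openin weak_star V \<and> f \<in> U \<and> g \<in> V \<and> disjnt U V"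
    using UV by (intro exI conjI) (assumption, assumption, auto simp: disjnt_def)
qed

lemma openin_weak_star_greater: "openin weak_star {f. a < blinfun_apply f x}"
  using openin_continuous_map_preimage[OF strong_operator_topology_continuous_evaluation, of "{a<..}" x]
  by (simp add: strong_operator_topology_topspace)

lemma closedin_weak_star_atMost: "closedin weak_star {f. blinfun_apply f x \<le> a}"
  using closedin_continuous_map_preimage[OF strong_operator_topology_continuous_evaluation, of "{..a}" x]
  by (simp add: strong_operator_topology_topspace)

lemma closedin_weak_star_atLeast: "closedin weak_star {f. a \<le> blinfun_apply f x}"
  using closedin_continuous_map_preimage[OF strong_operator_topology_continuous_evaluation, of "{a..}" x]
  by (simp add: strong_operator_topology_topspace)

section \<open>Norm boundedness of weak*-compact sets, Banach-Alaoglu and separation\<close>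

text \<open>Uniform boundedness principle: evaluations of \<open>A\<close> are compact, so the
  closed sets \<open>E n\<close> cover the space, and by Baire one of them contains a ball.
  Completeness of the space enters here.\<close>

lemma compactin_weak_star_bounded:
  fixes A :: "('a::banach \<Rightarrow>\<^sub>L real) set"
  assumes A: "compactin weak_star A"
  obtains R where "0 < R" "A \<subseteq> cball 0 R"
proof -
  define E where "E n = {x. \<forall>f\<in>A. \<bar>blinfun_apply f x\<bar> \<le> real n}" for n
  have "closed (E n)" for n
  proof -
    have "E n = (\<Inter>f\<in>A. {x. \<bar>blinfun_apply f x\<bar> \<le> real n})"
      by (auto simp: E_def)
    moreover have "closed {x. \<bar>blinfun_apply f x\<bar> \<le> real n}" for f :: "'a \<Rightarrow>\<^sub>L real"
      by (intro closed_Collect_le continuous_intros)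
    ultimately show ?thesis by auto
  qed
  moreover have "\<Union>(range E) = UNIV"
  proof -
    have "\<exists>n. x \<in> E n" for x
    proof -
      have "compactin euclidean ((\<lambda>f. blinfun_apply f x) ` A)"
        by (rule image_compactin[OF A strong_operator_topology_continuous_evaluation])
      then have "bounded ((\<lambda>f. blinfun_apply f x) ` A)"
        by (simp add: compact_imp_bounded)
      then obtain b where b: "\<And>f. f \<in> A \<Longrightarrow> \<bar>blinfun_apply f x\<bar> \<le> b"
        by (auto simp: bounded_iff)
      obtain n where "b \<le> real n" using real_arch_simple by blast
      then show ?thesis using b by (auto simp: E_def intro: order_trans)
    qed
    then show ?thesis by auto
  qed
  moreover have "completely_metrizable_space (euclidean :: 'a topology)"
    using completely_metrizable_space_euclidean by blast
  ultimately obtain n where "interior (E n) \<noteq> {}"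
    using Baire_category_alt[of "euclidean :: 'a topology" "range E"] by fastforce
  then obtain y where "y \<in> interior (E n)" by blast
  then obtain r where r: "0 < r" "cball y r \<subseteq> E n"
    by (metis mem_interior_cball)
  show thesis
  proof (rule that)
    show "0 < 2 * real n / r + 1"
      using r by (intro add_nonneg_pos divide_nonneg_pos) auto
    show "A \<subseteq> cball 0 (2 * real n / r + 1)"
    proof
      fix f assume f: "f \<in> A"
      have "norm f \<le> 2 * real n / r"
      proof (rule norm_blinfun_bound)
        show "0 \<le> 2 * real n / r" using r by simp
        fix x
        show "norm (blinfun_apply f x) \<le> 2 * real n / r * norm x"
        proof (cases "x = 0")
          case False
          \<comment> \<open>Rescaling \<open>x\<close> to norm \<open>r\<close> keeps
            \<open>y + c x\<close> in the ball; subtracting the bounds at the two points costs the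
            factor 2.\<close>
          define c where "c = r / norm x"
          have c: "0 < c" using r False by (simp add: c_def)
          have "y \<in> E n" "y + c *\<^sub>R x \<in> E n"
            using r False by (auto intro!: subsetD[OF r(2)] simp: dist_norm c_def)
          then have "\<bar>f y\<bar> \<le> real n" "\<bar>f y + c * f x\<bar> \<le> real n"
            using f by (auto simp: E_def blinfun.add_right blinfun.scaleR_right)
          then have "\<bar>c * f x\<bar> \<le> 2 * real n" by linarith
          then have "c * \<bar>f x\<bar> \<le> 2 * real n" using c by (simp add: abs_mult)
          then show ?thesis using r False by (simp add: c_def field_simps)
        qed simp
      qed
      then show "f \<in> cball 0 (2 * real n / r + 1)" by simp
    qed
  qed
qed

text \<open>Tychonoff: linearity is a closed condition in a product of compact intervals, and
  \<open>Blinfun\<close> carries the resulting compact set \<open>L\<close> continuously onto the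
  ball.\<close>

lemma Banach_Alaoglu: "compactin weak_star (cball (0 :: 'a::real_normed_vector \<Rightarrow>\<^sub>L real) R)"
proof -
  define L where "L = {\<phi> :: 'a \<Rightarrow> real. linear \<phi> \<and> (\<forall>x. \<bar>\<phi> x\<bar> \<le> R * norm x)}"
  \<comment> \<open>\<open>Blinfun\<close> is meaningful only on bounded linear maps; the bound by
    \<open>R\<close> makes every member of \<open>L\<close> one.\<close>
  have app: "blinfun_apply (Blinfun \<phi>) = \<phi>" if "\<phi> \<in> L" for \<phi>
    using that by (intro bounded_linear_Blinfun_apply)
      (auto simp: L_def linear_conv_bounded_linear mult.commute
        intro!: bounded_linear.intro bounded_linear_axioms.intro exI[of _ R])
  have "closed {\<phi> :: 'a \<Rightarrow> real. linear \<phi>}"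
  proof -
    have "{\<phi> :: 'a \<Rightarrow> real. linear \<phi>} =
      (\<Inter>x. \<Inter>y. {\<phi>. \<phi> (x + y) = \<phi> x + \<phi> y}) \<inter> (\<Inter>c. \<Inter>x. {\<phi>. \<phi> (c *\<^sub>R x) = c *\<^sub>R \<phi> x})"
      by (auto simp: linear_iff)
    also have "closed \<dots>"
      by (intro closed_Int closed_INT ballI closed_Collect_eq continuous_intros
          continuous_on_product_coordinates)
    finally show ?thesis .
  qed
  moreover have "compact (Pi\<^sub>E UNIV (\<lambda>x :: 'a. {- (R * norm x)..R * norm x}))"
    using compactin_PiE[of "\<lambda>_::'a. euclidean :: real topology" UNIV "\<lambda>x. {- (R * norm x)..R * norm x}"]
    by (simp add: euclidean_product_topology)
  ultimately have "compact ({\<phi> :: 'a \<Rightarrow> real. linear \<phi>} \<inter> Pi\<^sub>E UNIV (\<lambda>x :: 'a. {- (R * norm x)..R * norm x}))"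
    by (rule closed_Int_compact)
  also have "\<dots> = L" by (auto simp: L_def PiE_iff abs_le_iff minus_le_iff)
  finally have "compactin (subtopology euclidean L) L"
    by (simp add: compactin_subtopology)
  moreover have "continuous_map (subtopology euclidean L) weak_star Blinfun"
    unfolding continuous_on_strong_operator_topo_iff_coordinatewise
  proof
    fix x :: 'a
    have "continuous_on L (\<lambda>\<phi>. \<phi> x)"
      by (rule continuous_on_product_coordinates[THEN continuous_on_subset]) simp
    then show "continuous_map (subtopology euclidean L) euclidean (\<lambda>\<phi>. blinfun_apply (Blinfun \<phi>) x)"
      using app by (simp cong: continuous_on_cong)
  qed
  ultimately have "compactin weak_star (Blinfun ` L)"
    by (rule image_compactin)
  then show ?thesis
  proof (cases "0 \<le> R")
    case True
    have "Blinfun ` L = cball 0 R"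
    proof (intro equalityI subsetI)
      fix f assume "f \<in> Blinfun ` L"
      then obtain \<phi> where \<phi>: "\<phi> \<in> L" "f = Blinfun \<phi>" by auto
      then have "norm f \<le> R"
        using True app[OF \<phi>(1)] by (intro norm_blinfun_bound) (auto simp: L_def)
      then show "f \<in> cball 0 R" by simp
    next
      fix f :: "'a \<Rightarrow>\<^sub>L real" assume "f \<in> cball 0 R"
      then have "\<bar>f x\<bar> \<le> R * norm x" for x
        using norm_blinfun[of f x] mult_right_mono[of "norm f" R "norm x"] by simp
      then have "blinfun_apply f \<in> L"
        by (auto simp: L_def intro: bounded_linear.linear blinfun.bounded_linear_right)
      then show "f \<in> Blinfun ` L" by (metis blinfun_apply_inverse imageI)
    qed
    with \<open>compactin weak_star (Blinfun ` L)\<close> show ?thesis by simp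
  next
    \<comment> \<open>For a negative radius the ball is empty.\<close>
    case False
    then show ?thesis by simp
  qed
qed

text \<open>A finite set \<open>I\<close> determines a neighbourhood of \<open>f\<close> missing \<open>C\<close>; the variational inequality for
  the point \<open>h\<close> of \<open>C\<close> nearest to \<open>f\<close> in the Euclidean seminorm given by \<open>I\<close> yields \<open>x\<close>.\<close>

lemma weak_star_separation:
  assumes C: "compactin weak_star C" "convex C" "C \<noteq> {}" and f: "f \<notin> C"
  obtains x h where "h \<in> C" "blinfun_apply h x < blinfun_apply f x"
    "\<And>g. g \<in> C \<Longrightarrow> blinfun_apply g x \<le> blinfun_apply h x"
proof -
  have "openin weak_star (UNIV - C)"
    using compactin_imp_closedin[OF Hausdorff_weak_star C(1)]
    by (metis closedin_def strong_operator_topology_topspace)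
  then obtain I where I: "finite I" "\<And>g. (\<And>x. x \<in> I \<Longrightarrow> blinfun_apply g x = blinfun_apply f x) \<Longrightarrow> g \<notin> C"
    using f by (elim openin_weak_star_finite[of _ f]) auto
  define D where "D g = (\<Sum>x\<in>I. (blinfun_apply g x - blinfun_apply f x)\<^sup>2)" for g
  have "continuous_map weak_star euclidean D"
    unfolding D_def using I(1)
    by (intro continuous_intros strong_operator_topology_continuous_evaluation) auto
  then have "compact (D ` C)"
    using image_compactin[OF C(1)] by (metis compactin_euclidean_iff)
  then obtain h where h: "h \<in> C" "\<And>g. g \<in> C \<Longrightarrow> D h \<le> D g"
    using compact_attains_inf[of "D ` C"] C(3) by auto
  \<comment> \<open>Up to a factor this is the negative gradient of \<open>D\<close> at
    \<open>h\<close>: evaluation at \<open>x\<close> pairs the coordinates in \<open>I\<close> with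
    those of \<open>f - h\<close>.\<close>
  define x where "x = (\<Sum>i\<in>I. (f i - h i) *\<^sub>R i)"
  have app: "blinfun_apply g x = (\<Sum>i\<in>I. (f i - h i) * g i)" for g :: "'a \<Rightarrow>\<^sub>L real"
    by (simp add: x_def blinfun.sum_right blinfun.scaleR_right)
  show thesis
  proof (rule that[OF h(1)])
    have "D h > 0"
    proof (rule ccontr)
      assume "\<not> D h > 0"
      moreover have "0 \<le> D h" by (simp add: D_def sum_nonneg)
      ultimately have "D h = 0" by simp
      then have "blinfun_apply h i = f i" if "i \<in> I" for i
        using I(1) that by (auto simp: D_def sum_nonneg_eq_0_iff)
      then show False using I(2) h(1) by blast
    qed
    moreover have "blinfun_apply f x - h x = D h"
      by (simp add: app D_def sum_subtractf[symmetric] algebra_simps power2_eq_square)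
    ultimately show "blinfun_apply h x < f x" by simp
  next
    fix g assume g: "g \<in> C"
    define P Q where "P = blinfun_apply g x - h x" and "Q = (\<Sum>i\<in>I. (g i - h i)\<^sup>2)"
    have Q: "0 \<le> Q" by (simp add: Q_def sum_nonneg)
    \<comment> \<open>Expand \<open>D\<close> along the segment from \<open>h\<close> to
      \<open>g\<close>; its value at \<open>h\<close> is minimal.\<close>
    have *: "2 * P \<le> t * Q" if t: "0 < t" "t \<le> 1" for t
    proof -
      have "(1 - t) *\<^sub>R h + t *\<^sub>R g \<in> C"
        using C(2) h(1) g t by (auto simp: convex_alt)
      then have "D h \<le> D ((1 - t) *\<^sub>R h + t *\<^sub>R g)" by (rule h)
      also have "\<dots> = D h - 2 * t * P + t\<^sup>2 * Q"
        unfolding D_def P_def Q_def app sum_distrib_left sum_subtractf[symmetric] sum.distrib[symmetric]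
        by (rule sum.cong) (auto simp: blinfun.add_left blinfun.diff_left blinfun.scaleR_left algebra_simps power2_eq_square)
      finally have "t * (2 * P) \<le> t * (t * Q)" by (simp add: power2_eq_square algebra_simps)
      then show ?thesis using t by simp
    qed
    have "P \<le> 0"
    proof (rule ccontr)
      assume P: "\<not> P \<le> 0"
      \<comment> \<open>This \<open>t\<close> stays at most 1 and gives
        \<open>t * Q \<le> P\<close>; the summand 1 in the denominator covers
        \<open>Q = 0\<close>.\<close>
      then have "2 * P \<le> min 1 (P / (Q + 1)) * Q" using Q by (intro *) auto
      also have "\<dots> \<le> P / (Q + 1) * Q" using Q by (intro mult_right_mono) auto
      also have "\<dots> \<le> P" using P Q by (simp add: field_simps)
      finally show False using P by simp
    qed
    then show "blinfun_apply g x \<le> h x" by (simp add: P_def)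
  qed
qed


section \<open>Continuity of the vector operations and compactness of their images\<close>

text \<open>Continuity is joint in the pair, which makes thickenings of compact sets compact and
  closures of convex sets convex.\<close>

lemma continuous_map_weak_star_combination:
  "continuous_map (prod_topology weak_star weak_star) weak_star (\<lambda>(f, g). a *\<^sub>R f + b *\<^sub>R g)"
  unfolding continuous_on_strong_operator_topo_iff_coordinatewise
proof
  fix x :: 'a
  have "continuous_map (prod_topology weak_star weak_star) euclidean
      (\<lambda>p. a * blinfun_apply (fst p) x + b * blinfun_apply (snd p) x)"
    by (intro continuous_map_add continuous_map_real_mult continuous_map_const[THEN iffD2] disjI2
        continuous_map_compose[OF continuous_map_fst strong_operator_topology_continuous_evaluation, unfolded o_def]
        continuous_map_compose[OF continuous_map_snd strong_operator_topology_continuous_evaluation, unfolded o_def])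
      auto
  then show "continuous_map (prod_topology weak_star weak_star) euclidean
      (\<lambda>p. blinfun_apply (case p of (f, g) \<Rightarrow> a *\<^sub>R f + b *\<^sub>R g) x)"
    by (simp add: case_prod_unfold blinfun.add_left blinfun.scaleR_left)
qed

lemma continuous_map_weak_star_scaleR: "continuous_map weak_star weak_star (\<lambda>f. c *\<^sub>R f)"
  unfolding continuous_on_strong_operator_topo_iff_coordinatewise
proof
  fix x :: 'a
  have "continuous_map weak_star euclidean (\<lambda>f. c * blinfun_apply f x)"
    by (intro continuous_map_real_mult strong_operator_topology_continuous_evaluation) auto
  then show "continuous_map weak_star euclidean (\<lambda>f. blinfun_apply (c *\<^sub>R f) x)"
    by (simp add: blinfun.scaleR_left)
qed

lemma compactin_weak_star_scaleR:
  "compactin weak_star A \<Longrightarrow> compactin weak_star ((\<lambda>f. c *\<^sub>R f) ` A)"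
  by (rule image_compactin[OF _ continuous_map_weak_star_scaleR])

lemma compactin_weak_star_thickening:
  assumes "compactin weak_star A"
  shows "compactin weak_star {f + r *\<^sub>R g | f g. f \<in> A \<and> g \<in> cball 0 1}"
proof -
  have "compactin (prod_topology weak_star weak_star) (A \<times> cball 0 1)"
    using assms Banach_Alaoglu by (auto simp: compactin_Times)
  then have "compactin weak_star ((\<lambda>(f, g). 1 *\<^sub>R f + r *\<^sub>R g) ` (A \<times> cball 0 1))"
    using continuous_map_weak_star_combination by (rule image_compactin)
  also have "(\<lambda>(f, g). 1 *\<^sub>R f + r *\<^sub>R g) ` (A \<times> cball 0 1) =
      {f + r *\<^sub>R g | f g. f \<in> A \<and> g \<in> cball 0 1}"
    by (simp add: image_def Bex_def) blast
  finally show ?thesis .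
qed

subsection \<open>Weak*-closed convex hulls\<close>

lemma subset_weak_star_closed_hull: "A \<subseteq> weak_star_closed_hull A"
  unfolding weak_star_closed_hull_def
  by (metis closure_of_subset hull_subset order_trans strong_operator_topology_topspace subset_UNIV)

lemma weak_star_closed_hull_minimal:
  assumes "A \<subseteq> B" "convex B" "closedin weak_star B"
  shows "weak_star_closed_hull A \<subseteq> B"
  unfolding weak_star_closed_hull_def
  using assms by (intro closure_of_minimal hull_minimal)

lemma closedin_weak_star_closed_hull: "closedin weak_star (weak_star_closed_hull A)"
  by (simp add: weak_star_closed_hull_def)

text \<open>The closure of a product is the product of the closures, so the jointly continuous
  combination map sends pairs of limit points to limit points of the convex hull.\<close>

lemma convex_weak_star_closed_hull: "convex (weak_star_closed_hull A)"
proof (rule convexI)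
  fix f g and u v :: real
  assume fg: "f \<in> weak_star_closed_hull A" "g \<in> weak_star_closed_hull A"
    and uv: "0 \<le> u" "0 \<le> v" "u + v = 1"
  let ?c = "\<lambda>(f, g). u *\<^sub>R f + v *\<^sub>R g"
  have "?c ` (prod_topology weak_star weak_star closure_of ((convex hull A) \<times> (convex hull A)))
      \<subseteq> weak_star closure_of (?c ` ((convex hull A) \<times> (convex hull A)))"
    by (rule continuous_map_image_closure_subset[OF continuous_map_weak_star_combination])
  also have "\<dots> \<subseteq> weak_star_closed_hull A"
    unfolding weak_star_closed_hull_def
    using uv convex_convex_hull[of A] by (intro closure_of_mono) (auto intro: convexD)
  finally show "u *\<^sub>R f + v *\<^sub>R g \<in> weak_star_closed_hull A"
    using fg by (auto simp: closure_of_Times weak_star_closed_hull_def)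
qed

lemma weak_star_closed_hull_subset_cball:
  assumes "A \<subseteq> cball 0 R"
  shows "weak_star_closed_hull A \<subseteq> cball 0 R"
  by (rule weak_star_closed_hull_minimal[OF assms convex_cball
      compactin_imp_closedin[OF Hausdorff_weak_star Banach_Alaoglu]])

text \<open>A norm bound on \<open>A\<close> puts the hull, as a weak*-closed set, inside a compact
  ball.\<close>

lemma compactin_weak_star_closed_hull:
  fixes A :: "('a::banach \<Rightarrow>\<^sub>L real) set"
  assumes "compactin weak_star A"
  shows "compactin weak_star (weak_star_closed_hull A)"
proof -
  obtain R where "A \<subseteq> cball 0 R" using compactin_weak_star_bounded[OF assms] by blast
  then show ?thesis
    by (rule closed_compactin[OF Banach_Alaoglu weak_star_closed_hull_subset_cball closedin_weak_star_closed_hull])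
qed

text \<open>Mass \<open>t\<close> placed outside \<open>S\<close> lowers the value at
  \<open>x\<close> by at least \<open>t * (M - c)\<close> and moves the point at most
  \<open>2 * R * t\<close> away from the hull of \<open>S\<close>. A value above
  \<open>M - s * (M - c)\<close> thus forces \<open>t < s\<close>. The closure is harmless because
  the thickening is weak*-closed.\<close>

lemma weak_star_closed_hull_slice:
  fixes A :: "('a::real_normed_vector \<Rightarrow>\<^sub>L real) set" and x :: 'a and c M R s :: real
  defines "S \<equiv> {f \<in> A. c \<le> blinfun_apply f x}"
  assumes A: "A \<subseteq> cball 0 R" and M: "\<And>f. f \<in> A \<Longrightarrow> blinfun_apply f x \<le> M"
    and ne: "S \<noteq> {}" and S: "compactin weak_star (weak_star_closed_hull S)"
    and c: "c < M" and s: "0 < s" and R: "0 < R"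
    and f: "f \<in> weak_star_closed_hull A" "M - s * (M - c) < blinfun_apply f x"
  shows "f \<in> {g + (2 * R * s) *\<^sub>R h | g h. g \<in> weak_star_closed_hull S \<and> h \<in> cball 0 1}"
    (is "f \<in> ?T")
proof -
  \<comment> \<open>\<open>t\<close> bounds the mass that a convex combination \<open>g\<close> puts outside \<open>S\<close>.\<close>
  define D where "D = {g. \<exists>a\<in>convex hull S. \<exists>t\<ge>0.
      norm (g - a) \<le> 2 * R * t \<and> blinfun_apply g x \<le> M - t * (M - c)}"
  have "A \<subseteq> D"
  proof
    fix g assume g: "g \<in> A"
    \<comment> \<open>Points of \<open>S\<close> take \<open>t = 0\<close>; the others take
      \<open>t = 1\<close>, as any two points of \<open>A\<close> are at distance at most
      \<open>2 * R\<close>.\<close>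
    show "g \<in> D"
    proof (cases "g \<in> S")
      case True
      then have "g \<in> convex hull S" by (rule hull_inc)
      then show ?thesis using M[OF g] unfolding D_def by (intro CollectI bexI[of _ g] exI[of _ 0]) auto
    next
      case False
      obtain a where a: "a \<in> S" using ne by auto
      then have "norm g \<le> R" "norm a \<le> R" using A g by (auto simp: S_def)
      then have "norm (g - a) \<le> 2 * R" using norm_triangle_ineq4[of g a] by simp
      moreover have "blinfun_apply g x \<le> c" using False g by (simp add: S_def)
      ultimately show ?thesis
        using hull_inc[OF a, of convex] unfolding D_def by (intro CollectI bexI[of _ a] exI[of _ 1]) auto
    qed
  qed
  moreover have "convex D"
  proof (rule convexI)
    fix g h and u v :: real
    assume "g \<in> D" "h \<in> D" and uv: "0 \<le> u" "0 \<le> v" "u + v = 1"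
    then obtain a t b r where
      a: "a \<in> convex hull S" "0 \<le> t" "norm (g - a) \<le> 2 * R * t" "blinfun_apply g x \<le> M - t * (M - c)" and
      b: "b \<in> convex hull S" "0 \<le> r" "norm (h - b) \<le> 2 * R * r" "blinfun_apply h x \<le> M - r * (M - c)"
      unfolding D_def by blast
    have "norm ((u *\<^sub>R g + v *\<^sub>R h) - (u *\<^sub>R a + v *\<^sub>R b)) = norm (u *\<^sub>R (g - a) + v *\<^sub>R (h - b))"
      by (simp add: algebra_simps)
    also have "\<dots> \<le> u * norm (g - a) + v * norm (h - b)"
      using uv by (intro order_trans[OF norm_triangle_ineq]) simp
    also have "\<dots> \<le> u * (2 * R * t) + v * (2 * R * r)"
      using uv a b by (intro add_mono mult_left_mono)
    finally have n: "norm ((u *\<^sub>R g + v *\<^sub>R h) - (u *\<^sub>R a + v *\<^sub>R b)) \<le> 2 * R * (u * t + v * r)"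
      by (simp add: algebra_simps)
    have "u * blinfun_apply g x + v * blinfun_apply h x \<le> u * (M - t * (M - c)) + v * (M - r * (M - c))"
      using uv a b by (intro add_mono mult_left_mono)
    also have "\<dots> = (u + v) * M - (u * t + v * r) * (M - c)" by (simp add: algebra_simps)
    finally have "blinfun_apply (u *\<^sub>R g + v *\<^sub>R h) x \<le> M - (u * t + v * r) * (M - c)"
      using uv by (simp add: blinfun.add_left blinfun.scaleR_left)
    then show "u *\<^sub>R g + v *\<^sub>R h \<in> D"
      unfolding D_def using n a b uv convexD[OF convex_convex_hull a(1) b(1) uv]
      by (intro CollectI bexI[of _ "u *\<^sub>R a + v *\<^sub>R b"] exI[of _ "u * t + v * r"]) auto
  qed
  ultimately have hull: "convex hull A \<subseteq> D" by (rule hull_minimal)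
  let ?H = "{g. M - s * (M - c) < blinfun_apply g x}"
  have "convex hull A \<inter> ?H \<subseteq> ?T"
  proof
    fix g assume g: "g \<in> convex hull A \<inter> ?H"
    then obtain a t where a: "a \<in> convex hull S" "0 \<le> t" "norm (g - a) \<le> 2 * R * t"
      "blinfun_apply g x \<le> M - t * (M - c)"
      using hull unfolding D_def by blast
    have "t * (M - c) < s * (M - c)" using a g by simp
    then have "t \<le> s" using c by simp
    then have "norm (g - a) \<le> 2 * R * s" using a(3) R
      by (intro order_trans[OF a(3)] mult_left_mono) auto
    then have "norm (inverse (2 * R * s) *\<^sub>R (g - a)) \<le> 1"
      using R s by (simp only: norm_scaleR) (simp add: field_simps)
    then have "inverse (2 * R * s) *\<^sub>R (g - a) \<in> cball 0 1" by (simp only: mem_cball_0)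
    moreover have "g = a + (2 * R * s) *\<^sub>R (inverse (2 * R * s) *\<^sub>R (g - a))"
      using R s by (simp add: field_simps)
    moreover have "a \<in> weak_star_closed_hull S"
      using a(1) unfolding weak_star_closed_hull_def
      by (metis closure_of_subset strong_operator_topology_topspace subset_UNIV subsetD)
    ultimately show "g \<in> ?T" by blast
  qed
  moreover have "closedin weak_star ?T"
    by (rule compactin_imp_closedin[OF Hausdorff_weak_star compactin_weak_star_thickening[OF S]])
  ultimately have "weak_star closure_of (convex hull A \<inter> ?H) \<subseteq> ?T"
    by (rule closure_of_minimal)
  \<comment> \<open>As \<open>?H\<close> is open, a limit point of the convex hull lying in
    \<open>?H\<close> is a limit of hull points in \<open>?H\<close>.\<close>
  moreover have "f \<in> weak_star closure_of (convex hull A \<inter> ?H)"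
    using f openin_Int_closure_of_subset[OF openin_weak_star_greater, of "M - s * (M - c)" x "convex hull A"]
    unfolding weak_star_closed_hull_def by (auto simp: Int_commute)
  ultimately show ?thesis by blast
qed

subsection \<open>Measures of non-compactness and derivations\<close>

lemma noncompactness_Un:
  assumes "measure_of_noncompactness \<eta>" "compactin weak_star A" "compactin weak_star B"
  shows "\<eta> (A \<union> B) = max (\<eta> A) (\<eta> B)"
proof -
  define F where "F i = (if i = (1::nat) then A else B)" for i
  have "\<forall>i\<in>{1..2}. compactin weak_star (F i)" using assms(2,3) by (simp add: F_def)
  then have "\<eta> (\<Union>i\<in>{1..2}. F i) = Max ((\<lambda>i. \<eta> (F i)) ` {1..2})"
    using assms(1) unfolding measure_of_noncompactness_def by (metis one_le_numeral)
  moreover have "{1..2::nat} = {1, 2}" by auto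
  ultimately show ?thesis by (simp add: F_def)
qed

text \<open>The maximum axiom applied to \<open>A \<union> B = B\<close>.\<close>

lemma noncompactness_mono:
  assumes "measure_of_noncompactness \<eta>" "compactin weak_star A" "compactin weak_star B" "A \<subseteq> B"
  shows "\<eta> A \<le> \<eta> B"
  using noncompactness_Un[OF assms(1-3)] assms(4) by (simp add: Un_absorb1)

lemma noncompactness_nonneg:
  "measure_of_noncompactness \<eta> \<Longrightarrow> compactin weak_star A \<Longrightarrow> 0 \<le> \<eta> A"
  by (simp add: measure_of_noncompactness_def)

lemma noncompactness_Union_less:
  assumes \<eta>: "measure_of_noncompactness \<eta>" and "finite F" "\<And>A. A \<in> F \<Longrightarrow> compactin weak_star A"
    "\<And>A. A \<in> F \<Longrightarrow> \<eta> A < \<epsilon>" "0 < \<epsilon>"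
  shows "\<eta> (\<Union>F) < \<epsilon>"
  using assms(2-)
proof (induction F rule: finite_induct)
  case empty
  \<comment> \<open>The maximum axiom starts at one set, so the empty union is bounded through a
    singleton.\<close>
  have "\<eta> {} \<le> \<eta> {0}"
    by (rule noncompactness_mono[OF \<eta>]) (auto simp: strong_operator_topology_topspace)
  also have "\<eta> {0} = 0" using \<eta> by (simp add: measure_of_noncompactness_def)
  finally show ?case using empty by simp
next
  case (insert A F)
  then show ?case by (simp add: noncompactness_Un[OF \<eta>] compactin_Union)
qed

text \<open>Each point of \<open>B\<close> has a neighbourhood cutting from \<open>A\<close> a piece
  of measure below \<open>\<epsilon>\<close>. Compactness leaves finitely many such pieces, and the
  measure of their union is a maximum.\<close>

lemma noncompactness_less_off_fragment:
  assumes \<eta>: "measure_of_noncompactness \<eta>" and A: "compactin weak_star A"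
    and B: "compactin weak_star B" "B \<subseteq> A" "B \<inter> fragment_derivation \<eta> \<epsilon> A = {}" and "0 < \<epsilon>"
  shows "\<eta> B < \<epsilon>"
proof -
  define \<V> where "\<V> = {V. openin weak_star V \<and> \<eta> (A \<inter> (weak_star closure_of V)) < \<epsilon>}"
  have comp: "compactin weak_star (A \<inter> (weak_star closure_of U))" for U
    by (rule compact_Int_closedin[OF A closedin_closure_of])
  have "B \<subseteq> \<Union>\<V>"
  proof
    fix f assume "f \<in> B"
    then obtain U where U: "weak_star_neighbourhood f U" "\<eta> (A \<inter> (weak_star closure_of U)) < \<epsilon>"
      using B(2,3) unfolding fragment_derivation_def
      by (simp add: disjoint_iff not_le) blast
    then obtain V where V: "openin weak_star V" "f \<in> V" "V \<subseteq> U"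
      unfolding weak_star_neighbourhood_def by blast
    have "\<eta> (A \<inter> (weak_star closure_of V)) \<le> \<eta> (A \<inter> (weak_star closure_of U))"
      using closure_of_mono[OF V(3)] by (intro noncompactness_mono[OF \<eta>] comp) blast
    then show "f \<in> \<Union>\<V>" using U V by (auto simp: \<V>_def)
  qed
  then obtain F where F: "finite F" "F \<subseteq> \<V>" "B \<subseteq> \<Union>F"
    using compactinD[OF B(1), of \<V>] by (auto simp: \<V>_def)
  let ?F = "(\<lambda>V. A \<inter> (weak_star closure_of V)) ` F"
  have "B \<subseteq> \<Union>?F"
  proof
    fix f assume "f \<in> B"
    then obtain V where V: "V \<in> F" "f \<in> V" "f \<in> A" using F(3) B(2) by blast
    moreover have "V \<subseteq> weak_star closure_of V"
      by (simp add: closure_of_subset strong_operator_topology_topspace)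
    ultimately show "f \<in> \<Union>?F" by blast
  qed
  then have "\<eta> B \<le> \<eta> (\<Union>?F)"
    using F comp by (intro noncompactness_mono[OF \<eta> B(1)] compactin_Union) auto
  also have "\<dots> < \<epsilon>"
    using F comp \<open>0 < \<epsilon>\<close> by (intro noncompactness_Union_less[OF \<eta>]) (auto simp: \<V>_def)
  finally show ?thesis .
qed

section \<open>Compactness, monotonicity and scaling of the slice derivation\<close>

text \<open>The removed points are those of \<open>A\<close> in a union of open halfspaces.\<close>

lemma compactin_slice_derivation:
  assumes "compactin weak_star A"
  shows "compactin weak_star (slice_derivation \<eta> \<epsilon> A)"
proof -
  define \<H> where "\<H> = {H. weak_star_open_halfspace H \<and> \<not> \<epsilon> \<le> \<eta> (A \<inter> (weak_star closure_of H))}"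
  have "slice_derivation \<eta> \<epsilon> A = A \<inter> (UNIV - \<Union>\<H>)"
    unfolding slice_derivation_def \<H>_def by blast
  moreover have "openin weak_star (\<Union>\<H>)"
    unfolding \<H>_def weak_star_open_halfspace_def using openin_weak_star_greater by blast
  then have "closedin weak_star (UNIV - \<Union>\<H>)"
    by (metis closedin_diff closedin_topspace strong_operator_topology_topspace)
  ultimately show ?thesis using compact_Int_closedin[OF assms] by simp
qed

lemma slice_derivation_mono:
  assumes \<eta>: "measure_of_noncompactness \<eta>" and "compactin weak_star A" "compactin weak_star B" "A \<subseteq> B"
  shows "slice_derivation \<eta> \<epsilon> A \<subseteq> slice_derivation \<eta> \<epsilon> B"
proof -
  have "\<eta> (A \<inter> (weak_star closure_of H)) \<le> \<eta> (B \<inter> (weak_star closure_of H))" for H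
    using assms by (intro noncompactness_mono[OF \<eta>] compact_Int_closedin) auto
  then show ?thesis using assms(4) unfolding slice_derivation_def by (blast intro: order_trans)
qed

text \<open>Slices of the scaled set are scaled slices of \<open>K\<close>, with measure multiplied
  by \<open>c\<close>. Since \<open>c \<le> 1\<close>, a slice reaching \<open>\<epsilon>\<close>
  after scaling reached it before.\<close>

lemma slice_derivation_scaleR:
  assumes \<eta>: "measure_of_noncompactness \<eta>" "homogeneous \<eta>" and K: "compactin weak_star K"
    and c: "0 < c" "c \<le> 1"
  shows "slice_derivation \<eta> \<epsilon> ((\<lambda>f. c *\<^sub>R f) ` K) \<subseteq> (\<lambda>f. c *\<^sub>R f) ` slice_derivation \<eta> \<epsilon> K"
proof
  let ?s = "\<lambda>c f. c *\<^sub>R (f :: 'a \<Rightarrow>\<^sub>L real)"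
  fix f assume f: "f \<in> slice_derivation \<eta> \<epsilon> (?s c ` K)"
  then obtain k where k: "k \<in> K" "f = c *\<^sub>R k" by (auto simp: slice_derivation_def)
  have "\<epsilon> \<le> \<eta> (K \<inter> (weak_star closure_of H))"
    if H: "weak_star_open_halfspace H" "k \<in> H" for H
  proof -
    obtain x a where xa: "H = {h. a < blinfun_apply h x}"
      using H(1) by (auto simp: weak_star_open_halfspace_def)
    have inv: "?s (inverse c) ` ?s c ` H = H" for H using c by (auto simp: image_image)
    have "weak_star_open_halfspace {h. c * a < blinfun_apply h x}"
      unfolding weak_star_open_halfspace_def by blast
    moreover have "{h. c * a < blinfun_apply h x} = ?s c ` H"
    proof (intro equalityI subsetI)
      fix h assume "h \<in> {h. c * a < blinfun_apply h x}"
      then have "inverse c *\<^sub>R h \<in> H" using c by (simp add: xa blinfun.scaleR_left field_simps)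
      then show "h \<in> ?s c ` H" using c by (intro image_eqI[of _ _ "inverse c *\<^sub>R h"]) auto
    qed (use c in \<open>auto simp: xa blinfun.scaleR_left\<close>)
    ultimately have "weak_star_open_halfspace (?s c ` H)" by simp
    moreover have "f \<in> ?s c ` H" using k H by blast
    ultimately have "\<epsilon> \<le> \<eta> (?s c ` K \<inter> (weak_star closure_of (?s c ` H)))"
      using f by (simp add: slice_derivation_def)
    also have "\<dots> \<le> \<eta> (?s c ` (K \<inter> (weak_star closure_of H)))"
    proof (rule noncompactness_mono[OF \<eta>(1)])
      show "?s c ` K \<inter> (weak_star closure_of (?s c ` H)) \<subseteq> ?s c ` (K \<inter> (weak_star closure_of H))"
      proof
        fix g assume g: "g \<in> ?s c ` K \<inter> (weak_star closure_of (?s c ` H))"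
        then obtain h where h: "h \<in> K" "g = c *\<^sub>R h" by blast
        have "?s (inverse c) g \<in> weak_star closure_of (?s (inverse c) ` ?s c ` H)"
          using g continuous_map_image_closure_subset[OF continuous_map_weak_star_scaleR] by blast
        then have "h \<in> weak_star closure_of H" using h c by (simp add: inv)
        then show "g \<in> ?s c ` (K \<inter> (weak_star closure_of H))" using h by blast
      qed
    qed (intro compact_Int_closedin compactin_weak_star_scaleR K closedin_closure_of)+
    also have "\<dots> = c * \<eta> (K \<inter> (weak_star closure_of H))"
      using \<eta>(2) c compact_Int_closedin[OF K closedin_closure_of] by (simp add: homogeneous_def)
    also have "\<dots> \<le> 1 * \<eta> (K \<inter> (weak_star closure_of H))"
      using c K by (intro mult_right_mono noncompactness_nonneg[OF \<eta>(1)] compact_Int_closedin) auto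
    finally show ?thesis by simp
  qed
  then show "f \<in> ?s c ` slice_derivation \<eta> \<epsilon> K" using k by (auto simp: slice_derivation_def)
qed

section \<open>Shrinking of the hull under one derivation, and its iteration\<close>

text \<open>The factor \<open>\<mu>\<close> is fixed before any point is separated, from
  \<open>R\<close>, \<open>b\<close>, \<open>\<rho>\<close>, \<open>\<kappa>\<close> and the gap
  \<open>\<epsilon>' - \<epsilon>\<close> alone, so one factor serves all points and can be
  iterated.\<close>

lemma slice_derivation_hull_shrinks:
  fixes A :: "('a::banach \<Rightarrow>\<^sub>L real) set"
  assumes \<eta>: "measure_of_noncompactness \<eta>" and \<kappa>: "convexifiable_with \<eta> \<kappa>"
    and A: "compactin weak_star A" and \<rho>: "0 < \<rho>" "\<rho> < 1" and \<epsilon>: "0 < \<epsilon>" "\<epsilon> < \<epsilon>'"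
    and frag: "fragment_derivation \<eta> \<epsilon> A \<subseteq> (\<lambda>f. \<rho> *\<^sub>R f) ` A"
  obtains \<mu> where "0 < \<mu>" "\<mu> < 1"
    "slice_derivation \<eta> (\<kappa> * \<epsilon>') (weak_star_closed_hull A) \<subseteq> (\<lambda>f. \<mu> *\<^sub>R f) ` weak_star_closed_hull A"
proof -
  let ?K = "weak_star_closed_hull A"
  obtain R where R: "0 < R" "A \<subseteq> cball 0 R" using compactin_weak_star_bounded[OF A] .
  obtain b where b: "0 < b" "\<And>A r. compactin weak_star A \<Longrightarrow> 0 < r \<Longrightarrow>
      \<eta> {f + r *\<^sub>R g | f g. f \<in> A \<and> g \<in> cball 0 1} \<le> \<eta> A + r * b"
    using \<eta> unfolding measure_of_noncompactness_def by blast
  have \<kappa>1: "1 \<le> \<kappa>" using \<kappa> by (simp add: convexifiable_with_def)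
  define L where "L = (1 + \<rho>) / 2"
  have L: "0 < L" "\<rho> < L" "L < 1" using \<rho> by (auto simp: L_def)
  \<comment> \<open>Thickening by \<open>2 * R * s\<close> raises the measure by at most
    \<open>2 * R * s * b\<close>; this \<open>s\<close> keeps that within the spare amount
    \<open>\<kappa> * (\<epsilon>' - \<epsilon>)\<close>.\<close>
  define s where "s = min 1 (\<kappa> * (\<epsilon>' - \<epsilon>) / (2 * R * b))"
  have "s \<le> \<kappa> * (\<epsilon>' - \<epsilon>) / (2 * R * b)" by (simp add: s_def)
  then have s3: "2 * R * s * b \<le> \<kappa> * (\<epsilon>' - \<epsilon>)"
    using R(1) b(1) by (simp add: pos_le_divide_eq mult_ac)
  have s: "0 < s" "s \<le> 1" using R(1) b(1) \<kappa>1 \<epsilon> by (auto simp: s_def)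
  \<comment> \<open>Half of the admissible gap, so that \<open>\<mu> * M\<close> lies strictly above
    the level \<open>M - s * (M - L * M)\<close> required for the slice estimate.\<close>
  define \<mu> where "\<mu> = 1 - s * (1 - L) / 2"
  have sL: "0 < s * (1 - L)" "s * (1 - L) \<le> 1 - L"
    using s L mult_right_mono[of s 1 "1 - L"] by auto
  then have \<mu>: "0 < \<mu>" "\<mu> < 1" "1 - s * (1 - L) < \<mu>" using L by (auto simp: \<mu>_def field_simps)
  have K: "compactin weak_star ?K" by (rule compactin_weak_star_closed_hull[OF A])
  show thesis
  proof (rule that[OF \<mu>(1,2)], rule subsetI, rule ccontr)
    fix f assume f: "f \<in> slice_derivation \<eta> (\<kappa> * \<epsilon>') ?K"
      and "f \<notin> (\<lambda>f. \<mu> *\<^sub>R f) ` ?K"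
    moreover have "f \<in> ?K" using f by (simp add: slice_derivation_def)
    ultimately obtain x h where h: "h \<in> (\<lambda>f. \<mu> *\<^sub>R f) ` ?K" "blinfun_apply h x < blinfun_apply f x"
      "\<And>g. g \<in> (\<lambda>f. \<mu> *\<^sub>R f) ` ?K \<Longrightarrow> blinfun_apply g x \<le> blinfun_apply h x"
      using weak_star_separation[OF compactin_weak_star_scaleR[OF K]
          convex_scaling[OF convex_weak_star_closed_hull]] by (metis empty_iff image_is_empty)
    have sep: "\<mu> * blinfun_apply g x < blinfun_apply f x" if "g \<in> ?K" for g
      using h(2) h(3)[OF imageI[OF that]] by (simp add: blinfun.scaleR_left)
    have "A \<noteq> {}" using \<open>f \<in> ?K\<close> by (auto simp: weak_star_closed_hull_def)
    have "compact ((\<lambda>f. blinfun_apply f x) ` A)"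
      using image_compactin[OF A strong_operator_topology_continuous_evaluation]
      by (simp add: compactin_euclidean_iff)
    then obtain g0 where g0: "g0 \<in> A" "\<And>g. g \<in> A \<Longrightarrow> blinfun_apply g x \<le> blinfun_apply g0 x"
      using compact_attains_sup[of "(\<lambda>f. blinfun_apply f x) ` A"] \<open>A \<noteq> {}\<close> by auto
    define M where "M = blinfun_apply g0 x"
    have fM: "\<mu> * M < blinfun_apply f x"
      using sep[of g0] g0(1) subset_weak_star_closed_hull[of A] by (auto simp: M_def)
    have "?K \<subseteq> {g. blinfun_apply g x \<le> M}"
      using g0(2) by (intro weak_star_closed_hull_minimal closedin_weak_star_atMost)
        (auto simp: M_def convex_alt blinfun.add_left blinfun.scaleR_left intro!: convex_bound_le)
    \<comment> \<open>The value of \<open>f\<close> at \<open>x\<close> lies strictly above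
      \<open>\<mu> * M\<close> and is at most \<open>M\<close>; with \<open>\<mu> < 1\<close> this
      makes \<open>M\<close> positive.\<close>
    then have "\<mu> * M < M" using fM \<open>f \<in> ?K\<close> by auto
    then have "0 < (1 - \<mu>) * M" by (simp add: algebra_simps)
    then have M: "0 < M" using \<mu>(2) by (simp add: zero_less_mult_iff)
    define S where "S = {g \<in> A. L * M \<le> blinfun_apply g x}"
    have S: "compactin weak_star S"
      using compact_Int_closedin[OF A closedin_weak_star_atLeast, of "L * M" x]
      by (simp add: S_def Int_def)
    have "g0 \<in> S" using g0(1) L M by (simp add: S_def M_def)
    have "S \<inter> fragment_derivation \<eta> \<epsilon> A = {}"
    proof (rule ccontr)
      assume "S \<inter> fragment_derivation \<eta> \<epsilon> A \<noteq> {}"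
      then obtain g where g: "\<rho> *\<^sub>R g \<in> S" "g \<in> A" using frag by (auto simp: S_def)
      have "L * M \<le> \<rho> * blinfun_apply g x" using g(1) by (simp add: S_def blinfun.scaleR_left)
      also have "\<dots> \<le> \<rho> * M" using g0(2)[OF g(2)] \<rho> by (simp add: M_def)
      also have "\<dots> < L * M" using L M by simp
      finally show False by simp
    qed
    then have "\<eta> S < \<epsilon>"
      using S \<epsilon> by (intro noncompactness_less_off_fragment[OF \<eta> A]) (auto simp: S_def)
    have hS: "compactin weak_star (weak_star_closed_hull S)" by (rule compactin_weak_star_closed_hull[OF S])
    let ?H = "{g. \<mu> * M < blinfun_apply g x}"
    let ?T = "{g + (2 * R * s) *\<^sub>R h | g h. g \<in> weak_star_closed_hull S \<and> h \<in> cball 0 1}"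
    have "weak_star_open_halfspace ?H" unfolding weak_star_open_halfspace_def by blast
    then have "\<kappa> * \<epsilon>' \<le> \<eta> (?K \<inter> (weak_star closure_of ?H))"
      using f fM by (simp add: slice_derivation_def)
    also have "\<dots> \<le> \<eta> ?T"
    proof (rule noncompactness_mono[OF \<eta> compact_Int_closedin[OF K closedin_closure_of]
          compactin_weak_star_thickening[OF hS]], rule subsetI)
      fix g assume g: "g \<in> ?K \<inter> (weak_star closure_of ?H)"
      \<comment> \<open>Passing to the closure leaves only a weak inequality; the strict choice of
        \<open>\<mu>\<close> restores a strict one.\<close>
      have "weak_star closure_of ?H \<subseteq> {g. \<mu> * M \<le> blinfun_apply g x}"
        by (rule closure_of_minimal[OF _ closedin_weak_star_atLeast]) auto
      then have "\<mu> * M \<le> blinfun_apply g x" using g by auto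
      moreover have "M - s * (M - L * M) < \<mu> * M"
        using mult_strict_right_mono[OF \<mu>(3) M] by (simp add: algebra_simps)
      ultimately have "M - s * (M - L * M) < blinfun_apply g x" by simp
      then show "g \<in> ?T"
        unfolding S_def
        by (intro weak_star_closed_hull_slice[where M = M and A = A])
          (use g hS \<open>g0 \<in> S\<close> g0 R s L M in \<open>auto simp: S_def M_def\<close>)
    qed
    also have "\<dots> \<le> \<eta> (weak_star_closed_hull S) + 2 * R * s * b"
      using hS R s by (intro b(2)) auto
    also have "\<dots> \<le> \<kappa> * \<eta> S + \<kappa> * (\<epsilon>' - \<epsilon>)"
      using \<kappa> S s3 by (intro add_mono) (auto simp: convexifiable_with_def)
    also have "\<dots> < \<kappa> * \<epsilon> + \<kappa> * (\<epsilon>' - \<epsilon>)" using \<open>\<eta> S < \<epsilon>\<close> \<kappa>1 by simp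
    finally show False by (simp add: algebra_simps)
  qed
qed

theorem proposition3p4:
  fixes \<eta> :: "('a::banach \<Rightarrow>\<^sub>L real) set \<Rightarrow> real"
    and A :: "('a \<Rightarrow>\<^sub>L real) set"
    and \<kappa> lam \<epsilon> :: real
  assumes "measure_of_noncompactness \<eta>"
    and "homogeneous \<eta>"
    and "convexifiable \<eta>"
    and "\<kappa> = convexifiability_constant \<eta>"
    and "compactin weak_star A"
    and "0 < lam" and "lam < 1" and "0 < \<epsilon>"
    and "fragment_derivation \<eta> \<epsilon> A \<subseteq> (\<lambda>f. lam *\<^sub>R f) ` A"
  shows "\<forall>\<epsilon>'>\<epsilon>. slice_derivation_omega \<eta> (\<kappa> * \<epsilon>') (weak_star_closed_hull A) = {}"
proof (intro allI impI)
  fix \<epsilon>' assume \<epsilon>': "\<epsilon> < \<epsilon>'"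
  let ?K = "weak_star_closed_hull A" and ?D = "slice_derivation \<eta> (\<kappa> * \<epsilon>')"
  have \<kappa>: "convexifiable_with \<eta> \<kappa>" using assms(3,4) convexifiable_with_constant by metis
  then have pos: "0 < \<kappa> * \<epsilon>'" using assms(8) \<epsilon>' by (simp add: convexifiable_with_def)
  obtain \<mu> where \<mu>: "0 < \<mu>" "\<mu> < 1" "?D ?K \<subseteq> (\<lambda>f. \<mu> *\<^sub>R f) ` ?K"
    using slice_derivation_hull_shrinks[OF assms(1) \<kappa> assms(5) assms(6,7) assms(8) \<epsilon>' assms(9)] .
  have K: "compactin weak_star ?K" by (rule compactin_weak_star_closed_hull[OF assms(5)])
  have comp: "compactin weak_star ((?D ^^ k) ?K)" for k
    by (induction k) (auto intro: K compactin_slice_derivation)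
  \<comment> \<open>Only the inclusion for \<open>?K\<close> itself is known: monotonicity replaces
    the iterate by a scaled copy of \<open>?K\<close>, and scaling moves the derivation back to
    \<open>?K\<close>.\<close>
  have sub: "(?D ^^ k) ?K \<subseteq> (\<lambda>f. \<mu> ^ k *\<^sub>R f) ` ?K" for k
  proof (induction k)
    case (Suc k)
    have "(?D ^^ Suc k) ?K \<subseteq> ?D ((\<lambda>f. \<mu> ^ k *\<^sub>R f) ` ?K)"
      using slice_derivation_mono[OF assms(1) comp compactin_weak_star_scaleR[OF K] Suc] by simp
    also have "\<dots> \<subseteq> (\<lambda>f. \<mu> ^ k *\<^sub>R f) ` ?D ?K"
      using \<mu> by (intro slice_derivation_scaleR assms K) (auto simp: power_le_one)
    also have "\<dots> \<subseteq> (\<lambda>f. \<mu> ^ k *\<^sub>R f) ` (\<lambda>f. \<mu> *\<^sub>R f) ` ?K" using \<mu>(3) by (rule image_mono)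
    also have "\<dots> = (\<lambda>f. \<mu> ^ Suc k *\<^sub>R f) ` ?K" by (simp add: image_image mult.commute)
    finally show ?case .
  qed simp
  have "(\<lambda>k. \<mu> ^ k * \<eta> ?K) \<longlonglongrightarrow> 0 * \<eta> ?K"
    using \<mu> by (intro tendsto_intros LIMSEQ_realpow_zero) auto
  then have "eventually (\<lambda>k. \<mu> ^ k * \<eta> ?K < \<kappa> * \<epsilon>') sequentially"
    using pos by (simp add: order_tendstoD)
  then obtain k where k: "\<mu> ^ k * \<eta> ?K < \<kappa> * \<epsilon>'"
    by (auto simp: eventually_sequentially)
  have "\<eta> ((?D ^^ k) ?K) \<le> \<eta> ((\<lambda>f. \<mu> ^ k *\<^sub>R f) ` ?K)"
    by (rule noncompactness_mono[OF assms(1) comp compactin_weak_star_scaleR[OF K] sub])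
  also have "\<dots> = \<mu> ^ k * \<eta> ?K" using assms(2) K \<mu>(1) by (simp add: homogeneous_def)
  finally have small: "\<eta> ((?D ^^ k) ?K) < \<kappa> * \<epsilon>'" using k by simp
  \<comment> \<open>The degenerate halfspace with \<open>x = 0\<close> and level -1 has the whole
    iterate as its slice, so measure below \<open>\<kappa> * \<epsilon>'\<close> removes every point
    at the next step.\<close>
  have "weak_star_open_halfspace (UNIV :: ('a \<Rightarrow>\<^sub>L real) set)"
    unfolding weak_star_open_halfspace_def by (rule exI[of _ 0], rule exI[of _ "-1"]) simp
  then have "(?D ^^ Suc k) ?K = {}"
    using small closure_of_topspace[of weak_star]
    by (auto simp: slice_derivation_def strong_operator_topology_topspace)
  then show "slice_derivation_omega \<eta> (\<kappa> * \<epsilon>') ?K = {}"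
    unfolding slice_derivation_omega_def by blast
qed

end
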